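(* For a finitely generated group $G$, the following are equivalent: (1) $G$ has a $\Pi_3$ Scott sentence; (2) $G$ has a $d$-$\Sigma_2$ Scott sentence; (3) for some generating tuple of $G$, the orbit (under the automorphism group of $G$) is defined in $G$ by a $\Pi_1$ formula; (4) for each generating tuple of $G$, the orbit is defined in $G$ by a $\Pi_1$ formula.
   Context: Groups are structures in the language of groups (multiplication, inverse, identity), countably infinite with universe $\omega$. A generating tuple of $G$ is a finite tuple of elements generating $G$. Defining formulas have no parameters. $L_{\omega_1\omega}$-formulas (with finitely many free variables) in normal form are classified as follows. A formula is $\Sigma_0$ and $\Pi_0$ if it is finitary quantifier-free. For $\alpha>0$, $\varphi(\bar x)$ is $\Sigma_\alpha$ if it is a countable disjunction of formulas $(\exists \bar u)\psi(\bar x,\bar u)$ where each $\psi$ is $\Pi_\beta$ for some $\beta<\alpha$; and $\varphi(\bar x)$ is $\Pi_\alpha$ if it is a countable conjunction of formulas $(\forall\bar u)\psi(\bar x,\bar u)$ where each $\psi$ is $\Sigma_\beta$ for some $\beta<\alpha$. A formula is $d$-$\Sigma_\alpha$ if it is the conjunction of a $\Sigma_\alpha$ formula and a $\Pi_\alpha$ formula. A Scott sentence for $G$ is a sentence of $L_{\omega_1\omega}$ whose countable models are exactly the isomorphic copies of $G$. *)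

theory Defs
  imports "HOL-Algebra.Generated_Groups" "HOL-Library.Countable_Set_Type"
begin

section \<open>Structures in the language of groups\<close>

text \<open>A structure in the language of groups is an algebra with a binary, a unary and a nullary
  operation, not necessarily satisfying the group axioms.  The record of HOL-Algebra is extended
  because there the inverse is a derived operation, not part of the signature.\<close>

record 'a lg_struct = "'a monoid" +
  lg_inv :: "'a \<Rightarrow> 'a"

definition lg_structure :: "'a lg_struct \<Rightarrow> bool" where
  "lg_structure M \<longleftrightarrow>
     \<one>\<^bsub>M\<^esub> \<in> carrier M \<and>
     (\<forall>x\<in>carrier M. \<forall>y\<in>carrier M. x \<otimes>\<^bsub>M\<^esub> y \<in> carrier M) \<and>
     (\<forall>x\<in>carrier M. lg_inv M x \<in> carrier M)"

definition lg_of_group :: "'a monoid \<Rightarrow> 'a lg_struct" where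
  "lg_of_group G = \<lparr>carrier = carrier G, mult = mult G, one = one G, lg_inv = m_inv G\<rparr>"

text \<open>The set \<open>iso M N\<close> of the library consists of the bijections preserving multiplication.\<close>

definition lg_isomorphic :: "'a lg_struct \<Rightarrow> 'b lg_struct \<Rightarrow> bool" where
  "lg_isomorphic M N \<longleftrightarrow>
     (\<exists>h\<in>iso M N. h \<one>\<^bsub>M\<^esub> = \<one>\<^bsub>N\<^esub> \<and> (\<forall>x\<in>carrier M. h (lg_inv M x) = lg_inv N (h x)))"

section \<open>The logic \<open>L\<^sub>\<omega>\<^sub>1\<^sub>\<omega>\<close>\<close>

datatype gterm = Var nat | One | Mult gterm gterm | Inv gterm

text \<open>Countable conjunctions and disjunctions range over countable (possibly finite or empty)
  sets of formulas.\<close>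

datatype fm =
    Eq gterm gterm
  | Neg fm
  | Conj "fm cset"
  | Disj "fm cset"
  | Ex nat fm
  | All nat fm

primrec tval :: "'a lg_struct \<Rightarrow> (nat \<Rightarrow> 'a) \<Rightarrow> gterm \<Rightarrow> 'a" where
  "tval M e (Var i) = e i"
| "tval M e One = \<one>\<^bsub>M\<^esub>"
| "tval M e (Mult s t) = tval M e s \<otimes>\<^bsub>M\<^esub> tval M e t"
| "tval M e (Inv t) = lg_inv M (tval M e t)"

text \<open>The clauses for \<open>Conj\<close> and \<open>Disj\<close> go through \<open>cimage\<close> only to be primitive recursive; the
  usual forms are \<open>sat_Conj\<close> and \<open>sat_Disj\<close> below.\<close>

primrec sat :: "'a lg_struct \<Rightarrow> fm \<Rightarrow> (nat \<Rightarrow> 'a) \<Rightarrow> bool" where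
  "sat M (Eq s t) = (\<lambda>e. tval M e s = tval M e t)"
| "sat M (Neg \<phi>) = (\<lambda>e. \<not> sat M \<phi> e)"
| "sat M (Conj C) = (\<lambda>e. \<forall>P\<in>rcset (cimage (sat M) C). P e)"
| "sat M (Disj C) = (\<lambda>e. \<exists>P\<in>rcset (cimage (sat M) C). P e)"
| "sat M (Ex i \<phi>) = (\<lambda>e. \<exists>a\<in>carrier M. sat M \<phi> (e(i := a)))"
| "sat M (All i \<phi>) = (\<lambda>e. \<forall>a\<in>carrier M. sat M \<phi> (e(i := a)))"

lemma sat_Conj: "sat M (Conj C) e \<longleftrightarrow> (\<forall>\<phi>\<in>rcset C. sat M \<phi> e)"
  by (simp add: cimage.rep_eq)

lemma sat_Disj: "sat M (Disj C) e \<longleftrightarrow> (\<exists>\<phi>\<in>rcset C. sat M \<phi> e)"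
  by (simp add: cimage.rep_eq)

primrec tvars :: "gterm \<Rightarrow> nat set" where
  "tvars (Var i) = {i}"
| "tvars One = {}"
| "tvars (Mult s t) = tvars s \<union> tvars t"
| "tvars (Inv t) = tvars t"

primrec fv :: "fm \<Rightarrow> nat set" where
  "fv (Eq s t) = tvars s \<union> tvars t"
| "fv (Neg \<phi>) = fv \<phi>"
| "fv (Conj C) = \<Union> (rcset (cimage fv C))"
| "fv (Disj C) = \<Union> (rcset (cimage fv C))"
| "fv (Ex i \<phi>) = fv \<phi> - {i}"
| "fv (All i \<phi>) = fv \<phi> - {i}"

text \<open>\<open>holds M \<phi> xs\<close> is \<open>M \<Turnstile> \<phi>(xs)\<close>: the free variables are \<open>0, \<dots>, length xs - 1\<close>.  The value of
  the environment beyond \<open>length xs\<close> is a dummy, irrelevant when \<open>fv \<phi> \<subseteq> {..<length xs}\<close>.\<close>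

definition holds :: "'a lg_struct \<Rightarrow> fm \<Rightarrow> 'a list \<Rightarrow> bool" where
  "holds M \<phi> xs \<longleftrightarrow> sat M \<phi> (\<lambda>i. if i < length xs then xs ! i else \<one>\<^bsub>M\<^esub>)"

section \<open>Complexity of formulas\<close>

inductive finitary_qf :: "fm \<Rightarrow> bool" where
  "finitary_qf (Eq s t)"
| "finitary_qf \<phi> \<Longrightarrow> finitary_qf (Neg \<phi>)"
| "finite (rcset C) \<Longrightarrow> \<forall>\<phi>\<in>rcset C. finitary_qf \<phi> \<Longrightarrow> finitary_qf (Conj C)"
| "finite (rcset C) \<Longrightarrow> \<forall>\<phi>\<in>rcset C. finitary_qf \<phi> \<Longrightarrow> finitary_qf (Disj C)"

definition Exs :: "nat list \<Rightarrow> fm \<Rightarrow> fm" where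
  "Exs us \<phi> = foldr Ex us \<phi>"

definition Alls :: "nat list \<Rightarrow> fm \<Rightarrow> fm" where
  "Alls us \<phi> = foldr All us \<phi>"

text \<open>The hierarchy is defined at finite levels only; as membership at level \<open>n\<close> refers only to
  smaller levels, these coincide with the finite levels of the transfinite hierarchy.\<close>

inductive is_Sigma :: "nat \<Rightarrow> fm \<Rightarrow> bool" and is_Pi :: "nat \<Rightarrow> fm \<Rightarrow> bool" where
  Sigma_0: "finitary_qf \<phi> \<Longrightarrow> is_Sigma 0 \<phi>"
| Pi_0: "finitary_qf \<phi> \<Longrightarrow> is_Pi 0 \<phi>"
| Sigma_n: "n > 0 \<Longrightarrow> finite (fv (Disj C)) \<Longrightarrow>
    \<forall>\<phi>\<in>rcset C. \<exists>us \<psi> m. \<phi> = Exs us \<psi> \<and> m < n \<and> is_Pi m \<psi> \<Longrightarrow> is_Sigma n (Disj C)"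
| Pi_n: "n > 0 \<Longrightarrow> finite (fv (Conj C)) \<Longrightarrow>
    \<forall>\<phi>\<in>rcset C. \<exists>us \<psi> m. \<phi> = Alls us \<psi> \<and> m < n \<and> is_Sigma m \<psi> \<Longrightarrow> is_Pi n (Conj C)"

definition is_dSigma :: "nat \<Rightarrow> fm \<Rightarrow> bool" where
  "is_dSigma n \<phi> \<longleftrightarrow>
     (\<exists>\<psi> \<chi>. is_Sigma n \<psi> \<and> is_Pi n \<chi> \<and> \<phi> = Conj (cinsert \<psi> (csingle \<chi>)))"

section \<open>Scott sentences\<close>

text \<open>Every countable structure is isomorphic to one whose universe is a set of natural numbers, so
  it suffices to range over the latter.\<close>

definition scott_sentence :: "'a monoid \<Rightarrow> fm \<Rightarrow> bool" where
  "scott_sentence G \<phi> \<longleftrightarrow> fv \<phi> = {} \<and>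
     (\<forall>N :: nat lg_struct. lg_structure N \<longrightarrow>
        (holds N \<phi> [] \<longleftrightarrow> lg_isomorphic (lg_of_group G) N))"

section \<open>Generating tuples and orbits\<close>

definition generating_tuple :: "'a monoid \<Rightarrow> 'a list \<Rightarrow> bool" where
  "generating_tuple G xs \<longleftrightarrow> set xs \<subseteq> carrier G \<and> generate G (set xs) = carrier G"

definition fin_generated :: "'a monoid \<Rightarrow> bool" where
  "fin_generated G \<longleftrightarrow> (\<exists>xs. generating_tuple G xs)"

definition aut_orbit :: "'a monoid \<Rightarrow> 'a list \<Rightarrow> 'a list set" where
  "aut_orbit G xs = {map h xs | h. h \<in> iso G G}"

definition defines_in :: "'a monoid \<Rightarrow> fm \<Rightarrow> nat \<Rightarrow> 'a list set \<Rightarrow> bool" where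
  "defines_in G \<phi> k R \<longleftrightarrow> fv \<phi> \<subseteq> {..<k} \<and>
     R = {ys. length ys = k \<and> set ys \<subseteq> carrier G \<and> holds (lg_of_group G) \<phi> ys}"

end

theory Submission
  imports Defs
begin

text \<open>(1) implies (4): for a generating tuple \<open>a\<close> let \<open>p\<close> be the conjunction of all finitary universal
  formulas true of \<open>a\<close>.  If \<open>p\<close> holds of some \<open>b\<close> outside the orbit of \<open>a\<close>, then \<open>a \<mapsto> b\<close> extends to an
  embedding \<open>f\<close> of \<open>G\<close> into itself that is not onto and preserves universal formulas.  The limit of
  \<open>G \<rightarrow> G \<rightarrow> \<dots>\<close> along \<open>f\<close> satisfies every \<open>\<Pi>\<^sub>3\<close> sentence true in \<open>G\<close>, but it is not finitely generated,
  so \<open>G\<close> has no \<open>\<Pi>\<^sub>3\<close> Scott sentence.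

  (3) implies (2): let \<open>\<chi>\<close> be the conjunction of a \<open>\<Pi>\<^sub>1\<close> definition of the orbit of \<open>a\<close> with the
  quantifier-free type of \<open>a\<close>.  The Scott sentence says that some tuple satisfies \<open>\<chi>\<close> and that every
  tuple satisfying \<open>\<chi>\<close> generates.\<close>

section \<open>Formulas\<close>

lemma sat_Conj_acset:
  "countable A \<Longrightarrow> sat M (Conj (acset A)) e \<longleftrightarrow> (\<forall>\<phi>\<in>A. sat M \<phi> e)"
  by (simp only: sat_Conj) simp

lemma sat_Disj_acset:
  "countable A \<Longrightarrow> sat M (Disj (acset A)) e \<longleftrightarrow> (\<exists>\<phi>\<in>A. sat M \<phi> e)"
  by (simp only: sat_Disj) simp

lemma fv_Conj: "fv (Conj C) = (\<Union>\<phi>\<in>rcset C. fv \<phi>)"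
  by (simp add: cimage.rep_eq)

lemma fv_Disj: "fv (Disj C) = (\<Union>\<phi>\<in>rcset C. fv \<phi>)"
  by (simp add: cimage.rep_eq)

lemma fv_Alls: "fv (Alls us \<psi>) = fv \<psi> - set us"
  by (induction us) (auto simp: Alls_def)

lemma fv_Exs: "fv (Exs us \<psi>) = fv \<psi> - set us"
  by (induction us) (auto simp: Exs_def)

text \<open>Only \<open>set us\<close> matters, so a block of quantifiers becomes a single choice of
  values \<open>v\<close>, whatever the order or repetition of its variables.\<close>

lemma sat_Alls:
  "sat M (Alls us \<psi>) e \<longleftrightarrow>
     (\<forall>v. (\<forall>i\<in>set us. v i \<in> carrier M) \<longrightarrow> sat M \<psi> (override_on e v (set us)))"
proof (induction us arbitrary: e)
  case Nil
  then show ?case by (simp add: Alls_def)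
next
  case (Cons u us)
  have "sat M (Alls (u # us) \<psi>) e \<longleftrightarrow> (\<forall>a\<in>carrier M. sat M (Alls us \<psi>) (e(u := a)))"
    by (simp add: Alls_def)
  also have "\<dots> \<longleftrightarrow> (\<forall>v. (\<forall>i\<in>set (u # us). v i \<in> carrier M) \<longrightarrow>
      sat M \<psi> (override_on e v (set (u # us))))" (is "?L \<longleftrightarrow> ?R")
  proof
    assume L: ?L
    show ?R
    proof (intro allI impI)
      fix v assume v: "\<forall>i\<in>set (u # us). v i \<in> carrier M"
      have "override_on (e(u := v u)) v (set us) = override_on e v (set (u # us))"
        by (auto simp: override_on_def)
      moreover have "sat M \<psi> (override_on (e(u := v u)) v (set us))"
        using L v by (simp add: Cons del: fun_upd_apply)
      ultimately show "sat M \<psi> (override_on e v (set (u # us)))" by simp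
    qed
  next
    assume R: ?R
    show ?L
    proof
      fix a assume a: "a \<in> carrier M"
      show "sat M (Alls us \<psi>) (e(u := a))"
        unfolding Cons
      proof (intro allI impI)
        fix v assume v: "\<forall>i\<in>set us. v i \<in> carrier M"
        \<comment> \<open>If \<open>u\<close> occurs again in \<open>us\<close>, the inner
          quantifier wins, so \<open>a\<close> is used only where \<open>us\<close> does not already
          give a value.\<close>
        have "override_on (e(u := a)) v (set us)
            = override_on e (\<lambda>i. if i \<in> set us then v i else a) (set (u # us))"
          by (auto simp: override_on_def)
        then show "sat M \<psi> (override_on (e(u := a)) v (set us))"
          using R a v by simp
      qed
    qed
  qed
  finally show ?case .
qed

lemma sat_Exs:
  "sat M (Exs us \<psi>) e \<longleftrightarrow>
     (\<exists>v. (\<forall>i\<in>set us. v i \<in> carrier M) \<and> sat M \<psi> (override_on e v (set us)))"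
proof -
  have "sat M (Exs us \<psi>) e \<longleftrightarrow> \<not> sat M (Alls us (Neg \<psi>)) e"
    by (induction us arbitrary: e) (auto simp: Exs_def Alls_def)
  then show ?thesis by (simp add: sat_Alls)
qed

lemma tval_cong: "(\<And>i. i \<in> tvars t \<Longrightarrow> e i = e' i) \<Longrightarrow> tval M e t = tval M e' t"
  by (induction t) auto

lemma sat_cong: "(\<And>i. i \<in> fv \<phi> \<Longrightarrow> e i = e' i) \<Longrightarrow> sat M \<phi> e \<longleftrightarrow> sat M \<phi> e'"
proof (induction \<phi> arbitrary: e e')
  case (Eq s t)
  have "tval M e s = tval M e' s" "tval M e t = tval M e' t"
    by (rule tval_cong, simp add: Eq.prems)+
  then show ?case by simp
next
  case (Conj C)
  have "sat M \<psi> e = sat M \<psi> e'" if "\<psi> \<in> rcset C" for \<psi>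
    
  proof (rule Conj.IH[OF that])
    fix i assume "i \<in> fv \<psi>"
    then have "i \<in> fv (Conj C)" unfolding fv_Conj using that by blast
    then show "e i = e' i" by (rule Conj.prems)
  qed
  then show ?case unfolding sat_Conj by blast
next
  case (Disj C)
  have "sat M \<psi> e = sat M \<psi> e'" if "\<psi> \<in> rcset C" for \<psi>
    
  proof (rule Disj.IH[OF that])
    fix i assume "i \<in> fv \<psi>"
    then have "i \<in> fv (Disj C)" unfolding fv_Disj using that by blast
    then show "e i = e' i" by (rule Disj.prems)
  qed
  then show ?case unfolding sat_Disj by blast
next
  case (Neg \<phi>)
  have "sat M \<phi> e = sat M \<phi> e'"
    by (rule Neg.IH) (simp add: Neg.prems)
  then show ?case by simp
next
  case (Ex i \<phi>)
  have "sat M \<phi> (e(i := a)) = sat M \<phi> (e'(i := a))" for a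
    by (rule Ex.IH) (simp add: Ex.prems)
  then show ?case by simp
next
  case (All i \<phi>)
  have "sat M \<phi> (e(i := a)) = sat M \<phi> (e'(i := a))" for a
    by (rule All.IH) (simp add: All.prems)
  then show ?case by simp
qed

section \<open>Negation of universal formulas\<close>

text \<open>Negation is pushed through leading universal quantifiers only. The hierarchy is
  syntactic, so a negated universal formula must literally be an \<open>Exs\<close> formula to serve
  as a disjunct at level 1.\<close>

primrec dual :: "fm \<Rightarrow> fm" where
  "dual (Eq s t) = Neg (Eq s t)"
| "dual (Neg \<phi>) = Neg (Neg \<phi>)"
| "dual (Conj C) = Neg (Conj C)"
| "dual (Disj C) = Neg (Disj C)"
| "dual (Ex i \<phi>) = Neg (Ex i \<phi>)"
| "dual (All i \<phi>) = Ex i (dual \<phi>)"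

lemma sat_dual [simp]: "sat M (dual \<phi>) e \<longleftrightarrow> \<not> sat M \<phi> e"
  by (induction \<phi> arbitrary: e) auto

lemma fv_dual [simp]: "fv (dual \<phi>) = fv \<phi>"
  by (induction \<phi>) auto

text \<open>A quantifier-free \<open>\<psi>\<close> does not begin with \<open>All\<close>, so the
  recursion of \<open>dual\<close> stops exactly at the end of the block.\<close>

lemma dual_Alls: "finitary_qf \<psi> \<Longrightarrow> dual (Alls us \<psi>) = Exs us (Neg \<psi>)"
proof (induction us)
  case Nil
  then show ?case by (cases rule: finitary_qf.cases) (auto simp: Alls_def Exs_def)
qed (simp add: Alls_def Exs_def)

section \<open>Substitution of terms in universal formulas\<close>

primrec tsubst :: "(nat \<Rightarrow> gterm) \<Rightarrow> gterm \<Rightarrow> gterm" where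
  "tsubst \<sigma> (Var i) = \<sigma> i"
| "tsubst \<sigma> One = One"
| "tsubst \<sigma> (Mult s t) = Mult (tsubst \<sigma> s) (tsubst \<sigma> t)"
| "tsubst \<sigma> (Inv t) = Inv (tsubst \<sigma> t)"

lemma tval_tsubst: "tval M e (tsubst \<sigma> t) = tval M (\<lambda>i. tval M e (\<sigma> i)) t"
  by (induction t) auto

lemma tvars_tsubst: "tvars (tsubst \<sigma> t) = (\<Union>i\<in>tvars t. tvars (\<sigma> i))"
  by (induction t) auto

text \<open>Capture is ignored, so this is substitution on quantifier-free formulas only.\<close>

primrec qf_subst :: "(nat \<Rightarrow> gterm) \<Rightarrow> fm \<Rightarrow> fm" where
  "qf_subst \<sigma> (Eq s t) = Eq (tsubst \<sigma> s) (tsubst \<sigma> t)"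
| "qf_subst \<sigma> (Neg \<phi>) = Neg (qf_subst \<sigma> \<phi>)"
| "qf_subst \<sigma> (Conj C) = Conj (cimage (qf_subst \<sigma>) C)"
| "qf_subst \<sigma> (Disj C) = Disj (cimage (qf_subst \<sigma>) C)"
| "qf_subst \<sigma> (Ex i \<phi>) = Ex i (qf_subst \<sigma> \<phi>)"
| "qf_subst \<sigma> (All i \<phi>) = All i (qf_subst \<sigma> \<phi>)"

lemma sat_qf_subst:
  "finitary_qf \<psi> \<Longrightarrow> sat M (qf_subst \<sigma> \<psi>) e \<longleftrightarrow> sat M \<psi> (\<lambda>i. tval M e (\<sigma> i))"
  by (induction rule: finitary_qf.induct) (auto simp: tval_tsubst cimage.rep_eq)

lemma fv_qf_subst: "finitary_qf \<psi> \<Longrightarrow> fv (qf_subst \<sigma> \<psi>) = (\<Union>i\<in>fv \<psi>. tvars (\<sigma> i))"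
  by (induction rule: finitary_qf.induct) (auto simp: tvars_tsubst cimage.rep_eq)

lemma finitary_qf_qf_subst: "finitary_qf \<psi> \<Longrightarrow> finitary_qf (qf_subst \<sigma> \<psi>)"
  by (induction rule: finitary_qf.induct) (auto intro!: finitary_qf.intros simp: cimage.rep_eq)

text \<open>The bound variables are moved beyond \<open>k\<close>, out of the way of the substituted terms.\<close>

definition alls_subst :: "nat \<Rightarrow> (nat \<Rightarrow> gterm) \<Rightarrow> nat list \<Rightarrow> fm \<Rightarrow> fm" where
  "alls_subst k \<tau> us \<psi> =
     Alls (map ((+) k) us) (qf_subst (\<lambda>i. if i \<in> set us then Var (k + i) else \<tau> i) \<psi>)"

text \<open>The terms \<open>\<tau> i\<close> mention only variables below \<open>k\<close>, while
  the bound variables lie at \<open>k\<close> or beyond, so choosing values for the block does not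
  disturb the terms.\<close>

lemma sat_alls_subst:
  assumes qf: "finitary_qf \<psi>" and \<tau>: "\<And>i. tvars (\<tau> i) \<subseteq> {..<k}"
  shows "sat M (alls_subst k \<tau> us \<psi>) e \<longleftrightarrow> sat M (Alls us \<psi>) (\<lambda>i. tval M e (\<tau> i))"
proof -
  let ?\<sigma> = "\<lambda>i. if i \<in> set us then Var (k + i) else \<tau> i"
  have *: "(\<lambda>i. tval M (override_on e v (set (map ((+) k) us))) (?\<sigma> i))
      = override_on (\<lambda>i. tval M e (\<tau> i)) (\<lambda>i. v (k + i)) (set us)" for v
  proof
    fix i
    have "tval M (override_on e v (set (map ((+) k) us))) (\<tau> i) = tval M e (\<tau> i)"
      using \<tau>[of i] by (intro tval_cong) (auto simp: override_on_def)
    then show "tval M (override_on e v (set (map ((+) k) us))) (?\<sigma> i)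
        = override_on (\<lambda>i. tval M e (\<tau> i)) (\<lambda>i. v (k + i)) (set us) i"
      by (auto simp: override_on_def)
  qed
  show ?thesis
    unfolding alls_subst_def sat_Alls sat_qf_subst[OF qf] *
  proof (intro iffI allI impI)
    fix w
    assume A: "\<forall>v. (\<forall>i\<in>set (map ((+) k) us). v i \<in> carrier M) \<longrightarrow>
        sat M \<psi> (override_on (\<lambda>i. tval M e (\<tau> i)) (\<lambda>i. v (k + i)) (set us))"
      and w: "\<forall>i\<in>set us. w i \<in> carrier M"
    have "\<forall>i\<in>set (map ((+) k) us). w (i - k) \<in> carrier M" using w by simp
    then show "sat M \<psi> (override_on (\<lambda>i. tval M e (\<tau> i)) w (set us))"
      using A[THEN spec, THEN mp, of "\<lambda>i. w (i - k)"] by simp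
  qed simp
qed

lemma fv_alls_subst:
  assumes "finitary_qf \<psi>" and "\<And>i. tvars (\<tau> i) \<subseteq> {..<k}"
  shows "fv (alls_subst k \<tau> us \<psi>) \<subseteq> {..<k}"
proof -
  have "x < k" if "x \<in> tvars (\<tau> i)" for x i
    using assms(2)[of i] that by blast
  then show ?thesis
    using assms(1) by (auto simp: alls_subst_def fv_Alls fv_qf_subst split: if_splits)
qed

section \<open>Countability of the universal formulas\<close>

text \<open>The type \<open>fm\<close> is uncountable because of its countable sets. Lists in their
  place give a countable type whose image under \<open>decode\<close> contains every finitary
  quantifier-free formula.\<close>

datatype qf_code = CEq gterm gterm | CNeg qf_code | CConj "qf_code list" | CDisj "qf_code list"

primrec decode :: "qf_code \<Rightarrow> fm" where
  "decode (CEq s t) = Eq s t"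
| "decode (CNeg c) = Neg (decode c)"
| "decode (CConj cs) = Conj (acset (set (map decode cs)))"
| "decode (CDisj cs) = Disj (acset (set (map decode cs)))"

instance gterm :: countable
  by countable_datatype

instance qf_code :: countable
  by countable_datatype

lemma finitary_qf_in_range_decode: "finitary_qf \<psi> \<Longrightarrow> \<psi> \<in> range decode"
proof (induction rule: finitary_qf.induct)
  case (1 s t)
  then show ?case using decode.simps(1) by (metis rangeI)
next
  case (2 \<phi>)
  then show ?case using decode.simps(2) by (metis rangeE rangeI)
next
  case (3 C)
  then have "\<exists>B. finite B \<and> rcset C = decode ` B"
    by (meson finite_subset_image subsetI)
  then obtain cs where cs: "decode ` set cs = rcset C" by (metis finite_list)
  have "Conj C = decode (CConj cs)" by (simp add: cs rcset_inverse)
  then show ?case by (metis rangeI)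
next
  case (4 C)
  then have "\<exists>B. finite B \<and> rcset C = decode ` B"
    by (meson finite_subset_image subsetI)
  then obtain cs where cs: "decode ` set cs = rcset C" by (metis finite_list)
  have "Disj C = decode (CDisj cs)" by (simp add: cs rcset_inverse)
  then show ?case by (metis rangeI)
qed

text \<open>This allows all universal formulas true of a tuple to be put into one
  \<open>Conj\<close>, which takes only countable sets.\<close>

lemma countable_universal: "countable {Alls us \<psi> | us \<psi>. finitary_qf \<psi>}"
proof (rule countable_subset)
  show "{Alls us \<psi> | us \<psi>. finitary_qf \<psi>} \<subseteq> range (\<lambda>(us, c). Alls us (decode c))"
    using finitary_qf_in_range_decode by fastforce
qed simp

section \<open>Shape of formulas at the finite levels\<close>

lemma is_Sigma_0D: "is_Sigma 0 \<phi> \<Longrightarrow> finitary_qf \<phi>"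
  by (cases rule: is_Sigma.cases) auto

lemma is_Pi_0D: "is_Pi 0 \<phi> \<Longrightarrow> finitary_qf \<phi>"
  by (cases rule: is_Pi.cases) auto

lemma is_Sigma_SucD:
  assumes "is_Sigma (Suc n) \<phi>"
  obtains C where "\<phi> = Disj C" "finite (fv (Disj C))"
    "\<And>\<theta>. \<theta> \<in> rcset C \<Longrightarrow> \<exists>us \<psi> m. \<theta> = Exs us \<psi> \<and> m \<le> n \<and> is_Pi m \<psi>"
  using assms by (cases rule: is_Sigma.cases) (auto simp: less_Suc_eq_le)

lemma is_Pi_SucD:
  assumes "is_Pi (Suc n) \<phi>"
  obtains C where "\<phi> = Conj C" "finite (fv (Conj C))"
    "\<And>\<theta>. \<theta> \<in> rcset C \<Longrightarrow> \<exists>us \<psi> m. \<theta> = Alls us \<psi> \<and> m \<le> n \<and> is_Sigma m \<psi>"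
  using assms by (cases rule: is_Pi.cases) (auto simp: less_Suc_eq_le)

lemma is_Pi_1D:
  assumes "is_Pi 1 \<phi>"
  obtains C where "\<phi> = Conj C"
    "\<And>\<theta>. \<theta> \<in> rcset C \<Longrightarrow> \<exists>us \<psi>. \<theta> = Alls us \<psi> \<and> finitary_qf \<psi>"
proof -
  obtain C where C: "\<phi> = Conj C" "finite (fv (Conj C))"
    "\<And>\<theta>. \<theta> \<in> rcset C \<Longrightarrow> \<exists>us \<psi> m. \<theta> = Alls us \<psi> \<and> m \<le> 0 \<and> is_Sigma m \<psi>"
    using is_Pi_SucD[of 0 \<phi>] assms by (metis One_nat_def)
  then have "\<exists>us \<psi>. \<theta> = Alls us \<psi> \<and> finitary_qf \<psi>" if "\<theta> \<in> rcset C" for \<theta>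
    using that is_Sigma_0D by fastforce
  then show thesis using that C(1) by blast
qed

section \<open>Homomorphisms\<close>

definition lg_hom :: "'a lg_struct \<Rightarrow> 'b lg_struct \<Rightarrow> ('a \<Rightarrow> 'b) \<Rightarrow> bool" where
  "lg_hom M N h \<longleftrightarrow> h \<in> hom M N \<and> h \<one>\<^bsub>M\<^esub> = \<one>\<^bsub>N\<^esub> \<and>
     (\<forall>x\<in>carrier M. h (lg_inv M x) = lg_inv N (h x))"

lemma lg_isomorphic_iff:
  "lg_isomorphic M N \<longleftrightarrow> (\<exists>h. lg_hom M N h \<and> bij_betw h (carrier M) (carrier N))"
  by (auto simp: lg_isomorphic_def lg_hom_def iso_def)

lemma tval_closed:
  "lg_structure M \<Longrightarrow> (\<And>i. i \<in> tvars t \<Longrightarrow> e i \<in> carrier M) \<Longrightarrow> tval M e t \<in> carrier M"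
  by (induction t) (auto simp: lg_structure_def)

lemma tval_hom:
  assumes "lg_hom M N h" "lg_structure M"
  shows "(\<And>i. i \<in> tvars t \<Longrightarrow> e i \<in> carrier M) \<Longrightarrow> h (tval M e t) = tval N (h \<circ> e) t"
  using assms
  by (induction t) (auto simp: lg_hom_def hom_mult tval_closed[OF assms(2)])

text \<open>A homomorphism commutes with terms, and injectivity reflects equality of their values;
  Boolean combinations follow by induction.\<close>

lemma sat_embedding_qf:
  assumes "lg_hom M N h" "lg_structure M" "inj_on h (carrier M)" "\<And>i. e i \<in> carrier M"
    and "finitary_qf \<psi>"
  shows "sat N \<psi> (h \<circ> e) \<longleftrightarrow> sat M \<psi> e"
  using assms(5)
proof (induction rule: finitary_qf.induct)
  case (1 s t)
  then show ?case
    using tval_hom[OF assms(1,2), of s e] tval_hom[OF assms(1,2), of t e] assms(4)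
      inj_on_eq_iff[OF assms(3)] tval_closed[OF assms(2)] by (metis sat.simps(1))
next
  case (3 C)
  then show ?case by (simp add: sat_Conj del: sat.simps)
next
  case (4 C)
  then show ?case by (simp add: sat_Disj del: sat.simps)
qed simp

text \<open>Surjectivity makes quantifiers over \<open>carrier N\<close> range over the images
  \<open>h a\<close>, so the induction passes through every formula.\<close>

lemma sat_iso:
  assumes "lg_hom M N h" "lg_structure M" "bij_betw h (carrier M) (carrier N)"
  shows "(\<And>i. e i \<in> carrier M) \<Longrightarrow> sat N \<phi> (h \<circ> e) \<longleftrightarrow> sat M \<phi> e"
proof (induction \<phi> arbitrary: e)
  case (Eq s t)
  then show ?case
    using sat_embedding_qf[OF assms(1,2)] assms(3) finitary_qf.intros(1) bij_betw_def by metis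
next
  case (Conj C)
  then show ?case by (simp add: sat_Conj del: sat.simps)
next
  case (Disj C)
  then show ?case by (simp add: sat_Disj del: sat.simps)
next
  case (Ex i \<phi>)
  have "sat N \<phi> ((h \<circ> e)(i := h a)) = sat M \<phi> (e(i := a))" if "a \<in> carrier M" for a
    using Ex.prems that by (subst fun_upd_comp [symmetric], intro Ex.IH) simp
  moreover have "carrier N = h ` carrier M" using assms(3) by (simp add: bij_betw_def)
  ultimately show ?case by (simp del: fun_upd_apply o_apply)
next
  case (All i \<phi>)
  have "sat N \<phi> ((h \<circ> e)(i := h a)) = sat M \<phi> (e(i := a))" if "a \<in> carrier M" for a
    using All.prems that by (subst fun_upd_comp [symmetric], intro All.IH) simp
  moreover have "carrier N = h ` carrier M" using assms(3) by (simp add: bij_betw_def)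
  ultimately show ?case by (simp del: fun_upd_apply o_apply)
qed simp

lemma holds_iso:
  assumes "lg_hom M N h" "lg_structure M" "bij_betw h (carrier M) (carrier N)"
    and "set xs \<subseteq> carrier M"
  shows "holds N \<phi> (map h xs) \<longleftrightarrow> holds M \<phi> xs"
proof -
  let ?e = "\<lambda>i. if i < length xs then xs ! i else \<one>\<^bsub>M\<^esub>"
  have "?e i \<in> carrier M" for i
    using assms(2,4) by (auto simp: lg_structure_def dest: nth_mem)
  then have "sat N \<phi> (h \<circ> ?e) \<longleftrightarrow> sat M \<phi> ?e"
    by (rule sat_iso[OF assms(1-3)])
  moreover have "h \<circ> ?e = (\<lambda>i. if i < length (map h xs) then map h xs ! i else \<one>\<^bsub>N\<^esub>)"
    using assms(1) by (auto simp: lg_hom_def)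
  ultimately show ?thesis by (simp add: holds_def)
qed

section \<open>Groups as structures, and words in generators\<close>

lemma lg_of_group_simps [simp]:
  "carrier (lg_of_group G) = carrier G"
  "x \<otimes>\<^bsub>lg_of_group G\<^esub> y = x \<otimes>\<^bsub>G\<^esub> y"
  "\<one>\<^bsub>lg_of_group G\<^esub> = \<one>\<^bsub>G\<^esub>"
  "lg_inv (lg_of_group G) x = inv\<^bsub>G\<^esub> x"
  by (simp_all add: lg_of_group_def)

lemma lg_structure_lg_of_group: "group G \<Longrightarrow> lg_structure (lg_of_group G)"
  by (simp add: lg_structure_def group.is_monoid monoid.m_closed)

lemma lg_hom_lg_of_group:
  assumes "group G"
  shows "lg_hom (lg_of_group G) (lg_of_group G) h \<longleftrightarrow> h \<in> hom G G"
proof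
  assume "h \<in> hom G G"
  then interpret group_hom G G h
    using assms by (simp add: group_hom_def group_hom_axioms_def)
  show "lg_hom (lg_of_group G) (lg_of_group G) h"
    using \<open>h \<in> hom G G\<close> by (auto simp: lg_hom_def hom_def)
qed (auto simp: lg_hom_def hom_def)

text \<open>Words in the generators are closed under the clauses of \<open>generate\<close>.
  Elements of a finitely generated group can thus be replaced by terms.\<close>

lemma generate_eq_tval:
  assumes "g \<in> generate G (set xs)"
  shows "\<exists>t. tvars t \<subseteq> {..<length xs} \<and>
    g = tval (lg_of_group G) (\<lambda>i. if i < length xs then xs ! i else \<one>\<^bsub>G\<^esub>) t"
  using assms
proof (induction rule: generate.induct)
  case one
  then show ?case by (intro exI[of _ One]) simp
next
  case (incl h)
  then obtain i where "i < length xs" "h = xs ! i" by (metis in_set_conv_nth)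
  then show ?case by (intro exI[of _ "Var i"]) simp
next
  case (inv h)
  then obtain i where "i < length xs" "h = xs ! i" by (metis in_set_conv_nth)
  then show ?case by (intro exI[of _ "Inv (Var i)"]) simp
next
  case (eng h1 h2)
  then obtain s t where "tvars s \<subseteq> {..<length xs}" "tvars t \<subseteq> {..<length xs}"
    "h1 = tval (lg_of_group G) (\<lambda>i. if i < length xs then xs ! i else \<one>\<^bsub>G\<^esub>) s"
    "h2 = tval (lg_of_group G) (\<lambda>i. if i < length xs then xs ! i else \<one>\<^bsub>G\<^esub>) t"
    by blast
  then show ?case by (intro exI[of _ "Mult s t"]) simp
qed

text \<open>The map sends the value of a term at \<open>a\<close> to its value at \<open>b\<close>.
  One direction of \<open>eq\<close> makes this well defined, the other injective.\<close>

lemma embedding_from_generators: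
  fixes G :: "'a monoid" and N :: "'b lg_struct"
  defines "M \<equiv> lg_of_group G"
  assumes G: "group G" and gen: "generating_tuple G xs" and N: "lg_structure N"
    and a: "\<And>i. a i = (if i < length xs then xs ! i else \<one>\<^bsub>G\<^esub>)"
    and b: "\<And>i. i < length xs \<Longrightarrow> b i \<in> carrier N"
    and eq: "\<And>s t. tvars s \<subseteq> {..<length xs} \<Longrightarrow> tvars t \<subseteq> {..<length xs} \<Longrightarrow>
      tval M a s = tval M a t \<longleftrightarrow> tval N b s = tval N b t"
  obtains h where "lg_hom M N h" "inj_on h (carrier G)"
    "\<And>t. tvars t \<subseteq> {..<length xs} \<Longrightarrow> h (tval M a t) = tval N b t"
proof -
  let ?T = "{t. tvars t \<subseteq> {..<length xs}}"
  have M: "lg_structure M" using G by (simp add: M_def lg_structure_lg_of_group)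
  have ex: "\<exists>t\<in>?T. tval M a t = g" if "g \<in> carrier G" for g
    using that gen generate_eq_tval[of g G xs]
    by (auto simp: generating_tuple_def M_def ext[of a, OF a])
  \<comment> \<open>\<open>c\<close> chooses one word for each element; by \<open>eq\<close> the
    choice does not affect \<open>h\<close>.\<close>
  define c where "c g = (SOME t. t \<in> ?T \<and> tval M a t = g)" for g
  define h where "h g = tval N b (c g)" for g
  have c: "c g \<in> ?T" "tval M a (c g) = g" if "g \<in> carrier G" for g
    using someI_ex[of "\<lambda>t. t \<in> ?T \<and> tval M a t = g"] ex[OF that] by (auto simp: c_def)
  have aM: "a i \<in> carrier M" for i
    using gen M by (auto simp: a generating_tuple_def M_def lg_structure_def dest: nth_mem)
  have tM: "tval M a t \<in> carrier G" for t
    using tval_closed[OF M, of t a] aM by (simp add: M_def)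
  have h: "h (tval M a t) = tval N b t" if "t \<in> ?T" for t
    using eq[of "c (tval M a t)" t] c[OF tM[of t]] that by (simp add: h_def)
  have "h x \<in> carrier N" if "x \<in> carrier G" for x
    using c(1)[OF that] b by (auto simp: h_def intro!: tval_closed[OF N])
  \<comment> \<open>Each operation is a term constructor, so compatibility with it is an instance of
    the formula for \<open>h\<close> at a compound term.\<close>
  moreover have "h (x \<otimes>\<^bsub>M\<^esub> y) = h x \<otimes>\<^bsub>N\<^esub> h y" if "x \<in> carrier G" "y \<in> carrier G" for x y
    using h[of "Mult (c x) (c y)"] h[of "c x"] h[of "c y"] c[OF that(1)] c[OF that(2)] by simp
  moreover have "h \<one>\<^bsub>M\<^esub> = \<one>\<^bsub>N\<^esub>"
    using h[of One] by simp
  moreover have "h (lg_inv M x) = lg_inv N (h x)" if "x \<in> carrier G" for x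
    using h[of "Inv (c x)"] h[of "c x"] c[OF that] by simp
  ultimately have "lg_hom M N h"
    by (auto simp: lg_hom_def hom_def M_def)
  moreover have "inj_on h (carrier G)"
  proof (rule inj_onI)
    fix x y assume "x \<in> carrier G" "y \<in> carrier G" "h x = h y"
    then show "x = y" using eq[of "c x" "c y"] c[of x] c[of y] by (simp add: h_def)
  qed
  ultimately show thesis using that h by blast
qed


section \<open>Direct limits\<close>

text \<open>The limit identifies \<open>g\<close> at stage \<open>n\<close> with \<open>f g\<close>
  at stage \<open>Suc n\<close>. Its universe is coded in \<open>nat\<close> because
  \<open>scott_sentence\<close> tests only such structures.\<close>

lemma direct_limit:
  fixes M :: "'a::countable lg_struct"
  assumes M: "carrier M = UNIV" and f: "lg_hom M M f" "inj f"
  obtains N :: "nat lg_struct" and j where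
    "lg_structure N" "carrier N = (\<Union>n. range (j n))"
    "\<And>n. lg_hom M N (j n)" "\<And>n. inj (j n)" "\<And>n g. j (Suc n) (f g) = j n g"
proof -
  have fhom: "(f ^^ k) (x \<otimes>\<^bsub>M\<^esub> y) = (f ^^ k) x \<otimes>\<^bsub>M\<^esub> (f ^^ k) y" for k x y
    using f(1) M by (induction k) (auto simp: lg_hom_def hom_def)
  have fone: "(f ^^ k) \<one>\<^bsub>M\<^esub> = \<one>\<^bsub>M\<^esub>" for k
    using f(1) by (induction k) (auto simp: lg_hom_def)
  have finv: "(f ^^ k) (lg_inv M x) = lg_inv M ((f ^^ k) x)" for k x
    using f(1) M by (induction k) (auto simp: lg_hom_def)
  have finj: "(f ^^ k) x = (f ^^ k) y \<longleftrightarrow> x = y" for k x y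
    using inj_fn[OF f(2), of k] by (simp add: inj_eq)
  have fcomm: "(f ^^ k) ((f ^^ l) x) = (f ^^ l) ((f ^^ k) x)" for k l x
    by (metis add.commute comp_apply funpow_add)
  \<comment> \<open>Transitivity of the identification of \<open>(n, g)\<close> with
    \<open>(m, h)\<close> when \<open>(f ^^ m) g = (f ^^ n) h\<close>. Powers of \<open>f\<close>
    commute and are injective, so \<open>f ^^ m\<close> can be cancelled.\<close>
  have trans: "(f ^^ k) g = (f ^^ n) l"
    if "(f ^^ m) g = (f ^^ n) h" "(f ^^ k) h = (f ^^ m) l" for n m k g h l
  proof -
    have "(f ^^ m) ((f ^^ k) g) = (f ^^ m) ((f ^^ n) l)"
      using that by (metis fcomm)
    then show ?thesis by (simp add: finj)
  qed
  \<comment> \<open>\<open>(n, g)\<close> stands for \<open>g\<close> at stage \<open>n\<close>; a class of such pairs is represented by its least code.\<close>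
  define P where "P n g c \<longleftrightarrow> (\<exists>m h. c = to_nat (m, h) \<and> (f ^^ m) g = (f ^^ n) h)" for n :: nat and g and c
  define j where "j n g = (LEAST c. P n g c)" for n g
  have P: "P n g (j n g)" for n g
    unfolding j_def by (rule LeastI[of _ "to_nat (n, g)"]) (auto simp: P_def)
  have j_eq: "j n g = j m h \<longleftrightarrow> (f ^^ m) g = (f ^^ n) h" for n m g h
  proof
    assume "j n g = j m h"
    then have "P m h (j n g)" using P[of m h] by simp
    then obtain k l where "(f ^^ k) g = (f ^^ n) l" "(f ^^ k) h = (f ^^ m) l"
      using P[of n g] by (auto simp: P_def)
    then show "(f ^^ m) g = (f ^^ n) h" using trans[of k g n l m h] by simp
  next
    assume *: "(f ^^ m) g = (f ^^ n) h"
    have "P n g = P m h"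
      unfolding P_def using * trans[of m g n h] trans[of n h m g] by metis
    then show "j n g = j m h" by (simp add: j_def)
  qed
  \<comment> \<open>Operations are computed at a common stage; the result is independent of that
    stage because powers of \<open>f\<close> respect them.\<close>
  define N where "N = \<lparr>carrier = (\<Union>n. range (j n)),
    mult = (\<lambda>x y. SOME z. \<exists>n g h. x = j n g \<and> y = j n h \<and> z = j n (g \<otimes>\<^bsub>M\<^esub> h)),
    one = j 0 \<one>\<^bsub>M\<^esub>, lg_inv = (\<lambda>x. SOME z. \<exists>n g. x = j n g \<and> z = j n (lg_inv M g))\<rparr>"
  have mult: "j n g \<otimes>\<^bsub>N\<^esub> j n h = j n (g \<otimes>\<^bsub>M\<^esub> h)" for n g h
    unfolding N_def
    by (simp, rule some_equality) (auto simp: j_eq fhom)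
  have inv: "lg_inv N (j n g) = j n (lg_inv M g)" for n g
    unfolding N_def
    by (simp, rule some_equality) (auto simp: j_eq finv)
  have one: "\<one>\<^bsub>N\<^esub> = j n \<one>\<^bsub>M\<^esub>" for n
    by (simp add: N_def j_eq fone)
  have carrier: "carrier N = (\<Union>n. range (j n))" by (simp add: N_def)
  have step: "j (n + k) ((f ^^ k) g) = j n g" for n k g
    by (simp add: j_eq funpow_add)
  have hom: "lg_hom M N (j n)" for n
    by (auto simp: lg_hom_def hom_def carrier mult inv one[of n])
  have "lg_structure N"
    unfolding lg_structure_def
  proof (intro conjI ballI)
    fix x y assume "x \<in> carrier N" "y \<in> carrier N"
    then obtain n g m h where "x = j n g" "y = j m h" by (auto simp: carrier)
    then have "x = j (n + m) ((f ^^ m) g)" "y = j (n + m) ((f ^^ n) h)"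
      using step[of n m g] step[of m n h] by (simp_all add: add.commute)
    then show "x \<otimes>\<^bsub>N\<^esub> y \<in> carrier N" by (auto simp: mult carrier)
  next
    show "\<one>\<^bsub>N\<^esub> \<in> carrier N" by (auto simp: carrier one[of 0])
  next
    fix x assume "x \<in> carrier N"
    then obtain n g where "x = j n g" by (auto simp: carrier)
    then show "lg_inv N x \<in> carrier N" by (auto simp: inv carrier)
  qed
  then show thesis
    using that[of N j] carrier hom step[of _ 1] by (simp add: inj_def j_eq finj)
qed

text \<open>The environment is arbitrary, so parameters from all of \<open>M\<close> are allowed and
  the condition passes to the powers of \<open>f\<close>.\<close>

definition preserves_Pi_1 :: "'a lg_struct \<Rightarrow> ('a \<Rightarrow> 'a) \<Rightarrow> bool" where
  "preserves_Pi_1 M f \<longleftrightarrow>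
     (\<forall>us \<psi> e. finitary_qf \<psi> \<longrightarrow> sat M (Alls us \<psi>) e \<longrightarrow> sat M (Alls us \<psi>) (f \<circ> e))"

text \<open>The limit \<open>N\<close> of \<open>M \<rightarrow> M \<rightarrow> \<dots>\<close> along a map preserving universal formulas is a
  \<open>\<Sigma>\<^sub>1\<close>-elementary extension of every stage, which makes \<open>\<Pi>\<^sub>3\<close> sentences go up to \<open>N\<close>.\<close>

lemma Pi_3_direct_limit:
  fixes M :: "'a lg_struct" and N :: "'b lg_struct"
  assumes M: "carrier M = UNIV" "lg_structure M" and f: "preserves_Pi_1 M f"
    and carrier: "carrier N = (\<Union>n. range (j n))"
    and hom: "\<And>n. lg_hom M N (j n)" and inj: "\<And>n. inj (j n)"
    and step: "\<And>n g. j (Suc n) (f g) = j n g"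
    and \<phi>: "is_Pi 3 \<phi>" and sat: "holds M \<phi> []"
  shows "holds N \<phi> []"
proof -
  have qf: "sat N \<psi> (j n \<circ> e) \<longleftrightarrow> sat M \<psi> e" if "finitary_qf \<psi>" for \<psi> n e
    using sat_embedding_qf[OF hom M(2) _ _ that] inj M(1) by simp
  have stepk: "j (n + k) ((f ^^ k) g) = j n g" for n k g
    by (induction k) (simp_all add: step)
  \<comment> \<open>The block is finite, so its values, each from some stage, can all be moved to
    one stage beyond \<open>n\<close>.\<close>
  have stage: "\<exists>k. \<exists>w. \<forall>i\<in>set us. v i = j (n + k) (w i)"
    if "\<forall>i\<in>set us. v i \<in> carrier N" for us :: "nat list" and v n
    using that
  proof (induction us)
    case (Cons u us)
    then obtain k w where w: "\<forall>i\<in>set us. v i = j (n + k) (w i)" by auto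
    obtain m g where g: "v u = j m g" using Cons.prems by (auto simp: carrier)
    have "v i = j (n + (k + m)) (if i = u then (f ^^ (n + k)) g else (f ^^ m) (w i))"
      if "i \<in> set (u # us)" for i
      using that w g stepk[of m "n + k" g] stepk[of "n + k" m "w i"]
      by (auto simp: add.assoc add.commute add.left_commute)
    then show ?case
      by (intro exI[of _ "k + m"] exI[of _ "\<lambda>i. if i = u then (f ^^ (n + k)) g else (f ^^ m) (w i)"]) blast
  qed auto
  have f: "sat M (Alls us \<psi>) ((f ^^ k) \<circ> e)"
    if "finitary_qf \<psi>" "sat M (Alls us \<psi>) e" for us \<psi> k e
    using that f by (induction k) (auto simp: preserves_Pi_1_def comp_assoc)
  have univ: "sat N (Alls us \<psi>) (j n \<circ> e)"
    if \<psi>: "finitary_qf \<psi>" and sat: "sat M (Alls us \<psi>) e" for us \<psi> n e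
    unfolding sat_Alls
  proof (intro allI impI)
    fix v assume "\<forall>i\<in>set us. v i \<in> carrier N"
    then obtain k w where w: "\<forall>i\<in>set us. v i = j (n + k) (w i)" using stage by blast
    \<comment> \<open>Seen from stage \<open>n + k\<close>, the parameters are
      \<open>(f ^^ k) \<circ> e\<close>, which still satisfy the universal formula by
      preservation.\<close>
    have "override_on (j n \<circ> e) v (set us)
        = j (n + k) \<circ> override_on ((f ^^ k) \<circ> e) w (set us)"
      using w by (auto simp: override_on_def stepk)
    moreover have "sat M \<psi> (override_on ((f ^^ k) \<circ> e) w (set us))"
      using f[OF that] M by (simp add: sat_Alls)
    ultimately show "sat N \<psi> (override_on (j n \<circ> e) v (set us))"
      using qf[OF \<psi>] by simp
  qed
  have Pi: "sat N \<psi> (j n \<circ> e)" if "is_Pi m \<psi>" "m \<le> 1" "sat M \<psi> e" for \<psi> m n e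
  proof (cases "m = 0")
    case True
    then show ?thesis using qf that is_Pi_0D by blast
  next
    case False
    then have "is_Pi 1 \<psi>" using that by (metis le_antisym less_one linorder_not_le)
    then obtain C where C: "\<psi> = Conj C"
      "\<And>\<theta>. \<theta> \<in> rcset C \<Longrightarrow> \<exists>us \<psi>. \<theta> = Alls us \<psi> \<and> finitary_qf \<psi>"
      by (rule is_Pi_1D) blast
    then show ?thesis
      using univ that(3) unfolding C(1) sat_Conj by metis
  qed
  have Sigma: "sat N \<psi> (j n \<circ> e)" if "is_Sigma m \<psi>" "m \<le> 2" and sat: "sat M \<psi> e" for \<psi> m n e
  proof (cases m)
    case 0
    then show ?thesis using qf that is_Sigma_0D by blast
  next
    case (Suc l)
    then have "is_Sigma (Suc l) \<psi>" using that(1) by simp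
    then obtain C where C: "\<psi> = Disj C"
      "\<And>\<theta>. \<theta> \<in> rcset C \<Longrightarrow> \<exists>us \<psi> m. \<theta> = Exs us \<psi> \<and> m \<le> l \<and> is_Pi m \<psi>"
      by (rule is_Sigma_SucD) blast
    then obtain \<theta> where \<theta>: "\<theta> \<in> rcset C" "sat M \<theta> e"
      using sat unfolding C(1) sat_Disj by blast
    then obtain us \<chi> k where \<chi>: "\<theta> = Exs us \<chi>" "k \<le> l" "is_Pi k \<chi>" using C(2) by blast
    then obtain v where v: "sat M \<chi> (override_on e v (set us))"
      using \<theta>(2) unfolding \<chi>(1) sat_Exs by blast
    \<comment> \<open>Witnesses found in \<open>M\<close> are carried up by \<open>j n\<close>, and
      the matrix goes up with them by \<open>Pi\<close>.\<close>
    have "sat N \<chi> (j n \<circ> override_on e v (set us))"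
      using Pi[OF \<chi>(3) _ v] \<chi>(2) that(2) Suc by simp
    moreover have "j n \<circ> override_on e v (set us) = override_on (j n \<circ> e) (j n \<circ> v) (set us)"
      by (auto simp: override_on_def)
    ultimately have "sat N \<theta> (j n \<circ> e)"
      unfolding \<chi>(1) sat_Exs by (intro exI[of _ "j n \<circ> v"]) (auto simp: carrier)
    then show ?thesis using \<theta>(1) unfolding C(1) sat_Disj by blast
  qed
  have one: "j n \<one>\<^bsub>M\<^esub> = \<one>\<^bsub>N\<^esub>" for n using hom by (simp add: lg_hom_def)
  have "is_Pi (Suc 2) \<phi>" using \<phi> by simp
  then obtain C where C: "\<phi> = Conj C"
    "\<And>\<theta>. \<theta> \<in> rcset C \<Longrightarrow> \<exists>us \<psi> m. \<theta> = Alls us \<psi> \<and> m \<le> 2 \<and> is_Sigma m \<psi>"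
    by (rule is_Pi_SucD) blast
  have "sat N \<theta> (\<lambda>_. \<one>\<^bsub>N\<^esub>)" if \<theta>: "\<theta> \<in> rcset C" for \<theta>
  proof -
    obtain us \<psi> m where \<psi>: "\<theta> = Alls us \<psi>" "m \<le> 2" "is_Sigma m \<psi>" using C(2) \<theta> by blast
    have M\<theta>: "sat M \<theta> (\<lambda>_. \<one>\<^bsub>M\<^esub>)"
      using sat \<theta> unfolding C(1) holds_def sat_Conj by simp
    show ?thesis
      unfolding \<psi>(1) sat_Alls
    proof (intro allI impI)
      fix v assume "\<forall>i\<in>set us. v i \<in> carrier N"
      \<comment> \<open>Every stage is a copy of \<open>M\<close>, so the values can be read back in
        \<open>M\<close>, where the universal conjunct applies to them.\<close>
      then obtain k w where w: "\<forall>i\<in>set us. v i = j (0 + k) (w i)" using stage by blast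
      then have "override_on (\<lambda>_. \<one>\<^bsub>N\<^esub>) v (set us)
          = j k \<circ> override_on (\<lambda>_. \<one>\<^bsub>M\<^esub>) w (set us)"
        by (auto simp: override_on_def one)
      moreover have "sat M \<psi> (override_on (\<lambda>_. \<one>\<^bsub>M\<^esub>) w (set us))"
        using M\<theta> M unfolding \<psi>(1) sat_Alls by simp
      ultimately show "sat N \<psi> (override_on (\<lambda>_. \<one>\<^bsub>N\<^esub>) v (set us))"
        using Sigma \<psi> by simp
    qed
  qed
  then show ?thesis unfolding holds_def C(1) sat_Conj by simp
qed

text \<open>Under an isomorphism the images of the finitely many generators lie in one stage, hence
  so does all of \<open>N\<close>. But the stages increase strictly when \<open>f\<close> is not
  onto.\<close>

lemma direct_limit_not_isomorphic:
  assumes G: "group G" "carrier G = UNIV" "generating_tuple G xs"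
    and carrier: "carrier N = (\<Union>n. range (j n))"
    and hom: "\<And>n. lg_hom (lg_of_group G) N (j n)" and inj: "\<And>n. inj (j n)"
    and step: "\<And>n g. j (Suc n) (f g) = j n g"
    and f: "\<not> surj f"
  shows "\<not> lg_isomorphic (lg_of_group G) N"
proof
  assume "lg_isomorphic (lg_of_group G) N"
  then obtain h where h: "lg_hom (lg_of_group G) N h" "bij_betw h UNIV (carrier N)"
    by (auto simp: lg_isomorphic_iff G(2))
  have "range (j n) \<subseteq> range (j (Suc n))" for n
    by (rule image_subsetI, subst step[symmetric]) simp
  then have mono: "range (j n) \<subseteq> range (j (n + k))" for n k
    by (rule lift_Suc_mono_le[of "\<lambda>n. range (j n)"]) simp_all
  have "\<exists>n. h ` set ys \<subseteq> range (j n)" for ys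
  proof (induction ys)
    case (Cons y ys)
    then obtain n where n: "h ` set ys \<subseteq> range (j n)" by blast
    have "h y \<in> carrier N" using h(2) by (auto simp: bij_betw_def)
    then obtain m where m: "h y \<in> range (j m)" by (auto simp: carrier)
    have "h ` set (y # ys) \<subseteq> range (j (n + m))"
      using n m mono[of n m] mono[of m n] by (auto simp: add.commute)
    then show ?case by blast
  qed simp
  then obtain n where n: "h ` set xs \<subseteq> range (j n)" by blast
  have "h g \<in> range (j n)" if "g \<in> generate G (set xs)" for g
    using that
  proof (induction rule: generate.induct)
    case one
    have "h \<one>\<^bsub>G\<^esub> = j n \<one>\<^bsub>G\<^esub>" using h(1) hom[of n] by (simp add: lg_hom_def)
    then show ?case by simp
  next
    case (inv g)
    then obtain a where "h g = j n a" using n by blast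
    then have "h (inv\<^bsub>G\<^esub> g) = j n (inv\<^bsub>G\<^esub> a)"
      using h(1) hom[of n] G(2) by (simp add: lg_hom_def)
    then show ?case by simp
  next
    case (eng g1 g2)
    then obtain a b where "h g1 = j n a" "h g2 = j n b" by blast
    then have "h (g1 \<otimes>\<^bsub>G\<^esub> g2) = j n (a \<otimes>\<^bsub>G\<^esub> b)"
      using h(1) hom[of n] G(2) by (simp add: lg_hom_def hom_def)
    then show ?case by simp
  qed (use n in auto)
  then have "h g \<in> range (j n)" for g
    using G by (simp add: generating_tuple_def)
  then have "carrier N \<subseteq> range (j n)"
    using h(2) by (metis bij_betw_imp_surj_on image_subsetI)
  \<comment> \<open>Since \<open>j n\<close> is \<open>j (Suc n) \<circ> f\<close>, an element
    outside the range of \<open>f\<close> yields one at stage \<open>Suc n\<close> that is not at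
    stage \<open>n\<close>.\<close>
  moreover obtain g where g: "g \<notin> range f" using f by blast
  ultimately obtain a where "j (Suc n) g = j n a" using carrier by blast
  then have "j (Suc n) g = j (Suc n) (f a)" by (simp add: step)
  then show False using inj[of "Suc n"] g by (auto simp: inj_eq)
qed

section \<open>Orbits of generating tuples\<close>

lemma orbit_definable_of_Pi_3:
  fixes G :: "nat monoid"
  assumes G: "group G" "carrier G = UNIV" "generating_tuple G xs"
    and \<phi>: "is_Pi 3 \<phi>" "scott_sentence G \<phi>"
  shows "\<exists>\<phi>. is_Pi 1 \<phi> \<and> defines_in G \<phi> (length xs) (aut_orbit G xs)"
proof -
  let ?M = "lg_of_group G" and ?k = "length xs"
  define env where "env ys i = (if i < length ys then ys ! i else \<one>\<^bsub>G\<^esub>)" for ys i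
  have holds: "holds ?M \<theta> ys \<longleftrightarrow> sat ?M \<theta> (env ys)" for \<theta> ys
    by (simp add: holds_def env_def[abs_def] cong: if_cong)
  have M: "carrier ?M = UNIV" "lg_structure ?M"
    using G by (simp_all add: lg_structure_lg_of_group)
  define A where "A = {\<theta>. (\<exists>us \<psi>. \<theta> = Alls us \<psi> \<and> finitary_qf \<psi>) \<and> fv \<theta> \<subseteq> {..<?k} \<and> holds ?M \<theta> xs}"
  have cA: "countable A"
    by (rule countable_subset[OF _ countable_universal]) (auto simp: A_def)
  define p where "p = Conj (acset A)"
  have p: "holds ?M p ys \<longleftrightarrow> (\<forall>\<theta>\<in>A. holds ?M \<theta> ys)" for ys
    unfolding p_def holds_def by (rule sat_Conj_acset[OF cA])
  have fvp: "fv p \<subseteq> {..<?k}"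
    unfolding p_def fv_Conj using cA by (auto simp: A_def)
  have "is_Pi 1 p"
    unfolding p_def
  proof (rule Pi_n)
    show "finite (fv (Conj (acset A)))" using fvp finite_subset unfolding p_def by blast
    show "\<forall>\<phi>\<in>rcset (acset A). \<exists>us \<psi> m. \<phi> = Alls us \<psi> \<and> m < 1 \<and> is_Sigma m \<psi>"
      using cA Sigma_0 by (fastforce simp: A_def)
  qed simp
  moreover have "ys \<in> aut_orbit G xs" if ys: "length ys = ?k" "holds ?M p ys" for ys
  proof -
    have universal: "sat ?M \<theta> (env ys)"
      if "\<theta> = Alls us \<psi>" "finitary_qf \<psi>" "fv \<theta> \<subseteq> {..<?k}" "sat ?M \<theta> (env xs)" for \<theta> us \<psi>
    proof -
      have "\<theta> \<in> A" using that by (auto simp: A_def holds)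
      then have "holds ?M \<theta> ys" using ys(2) p by blast
      then show ?thesis by (simp add: holds)
    qed
    \<comment> \<open>Equations and negated equations are universal formulas with an empty block, so
      equality of words transfers in both directions.\<close>
    have eq: "tval ?M (env xs) s = tval ?M (env xs) t \<longleftrightarrow> tval ?M (env ys) s = tval ?M (env ys) t"
      if "tvars s \<subseteq> {..<?k}" "tvars t \<subseteq> {..<?k}" for s t
      using universal[of "Eq s t" "[]" "Eq s t"] universal[of "Neg (Eq s t)" "[]" "Neg (Eq s t)"] that
      by (auto simp: Alls_def intro: finitary_qf.intros)
    obtain f where f: "lg_hom ?M ?M f" "inj_on f (carrier G)"
      "\<And>t. tvars t \<subseteq> {..<?k} \<Longrightarrow> f (tval ?M (env xs) t) = tval ?M (env ys) t"
      by (rule embedding_from_generators[OF G(1,3) M(2) env_def _ eq]) (auto simp: G(2))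
    have injf: "inj f" using f(2) G(2) by simp
    have map: "map f xs = ys"
    proof (rule nth_equalityI)
      fix i assume "i < length (map f xs)"
      then show "map f xs ! i = ys ! i" using f(3)[of "Var i"] ys(1) by (simp add: env_def)
    qed (simp add: ys(1))
    have "preserves_Pi_1 ?M f"
      unfolding preserves_Pi_1_def
    proof (intro allI impI)
      fix us \<psi> e assume \<psi>: "finitary_qf \<psi>" "sat ?M (Alls us \<psi>) e"
      \<comment> \<open>Writing the parameters as words in \<open>xs\<close> turns the formula into
        a universal one about \<open>xs\<close> alone. It then holds of \<open>ys\<close>, where the
        same words give \<open>f \<circ> e\<close>.\<close>
      have "\<exists>t. tvars t \<subseteq> {..<?k} \<and> e i = tval ?M (env xs) t" for i
        using generate_eq_tval[of "e i" G xs] G(2,3) by (simp add: generating_tuple_def env_def[abs_def])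
      then obtain \<tau> where \<tau>: "\<And>i. tvars (\<tau> i) \<subseteq> {..<?k}" "\<And>i. e i = tval ?M (env xs) (\<tau> i)"
        by metis
      then have e: "e = (\<lambda>i. tval ?M (env xs) (\<tau> i))" "f \<circ> e = (\<lambda>i. tval ?M (env ys) (\<tau> i))"
        using f(3) by auto
      have "sat ?M (alls_subst ?k \<tau> us \<psi>) (env xs)"
        using sat_alls_subst[of \<psi> \<tau> ?k ?M, OF \<psi>(1) \<tau>(1)] \<psi>(2) e(1) by simp
      then have "sat ?M (alls_subst ?k \<tau> us \<psi>) (env ys)"
        using fv_alls_subst[of \<psi> \<tau>, OF \<psi>(1) \<tau>(1)] finitary_qf_qf_subst[OF \<psi>(1)]
        by (intro universal) (simp_all add: alls_subst_def)
      then show "sat ?M (Alls us \<psi>) (f \<circ> e)"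
        using sat_alls_subst[of \<psi> \<tau> ?k ?M, OF \<psi>(1) \<tau>(1)] e(2) by simp
    qed
    have "surj f"
    proof (rule ccontr)
      assume "\<not> surj f"
      obtain N :: "nat lg_struct" and j where N: "lg_structure N" "carrier N = (\<Union>n. range (j n))"
        "\<And>n. lg_hom ?M N (j n)" "\<And>n. inj (j n)" "\<And>n g. j (Suc n) (f g) = j n g"
        by (rule direct_limit[OF M(1) f(1) injf], rule that)
      \<comment> \<open>\<open>G\<close> lives on \<open>nat\<close>, so it is among the structures
        tested by \<open>scott_sentence\<close> and satisfies \<open>\<phi>\<close> itself.\<close>
      have "lg_isomorphic ?M ?M"
        unfolding lg_isomorphic_iff by (intro exI[of _ id]) (auto simp: lg_hom_def hom_def)
      then have "holds ?M \<phi> []" using \<phi>(2) M(2) by (simp add: scott_sentence_def)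
      then have "holds N \<phi> []"
        by (rule Pi_3_direct_limit[where j = j, OF M \<open>preserves_Pi_1 ?M f\<close> N(2-5) \<phi>(1)])
      then have "lg_isomorphic ?M N" using \<phi>(2) N(1) by (simp add: scott_sentence_def)
      moreover have "\<not> lg_isomorphic ?M N"
        by (rule direct_limit_not_isomorphic[where j = j and f = f, OF G N(2-5) \<open>\<not> surj f\<close>])
      ultimately show False by simp
    qed
    then have "f \<in> iso G G"
      using f(1) injf G(2) by (auto simp: iso_def lg_hom_lg_of_group[OF G(1)] bij_betw_def)
    then show ?thesis using map by (auto simp: aut_orbit_def)
  qed
  \<comment> \<open>Conversely, \<open>p\<close> holds of \<open>xs\<close> by construction, and
    automorphisms preserve it.\<close>
  moreover have "length ys = ?k \<and> holds ?M p ys" if ys: "ys \<in> aut_orbit G xs" for ys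
  proof -
    obtain h where h: "ys = map h xs" "h \<in> hom G G" "bij_betw h (carrier G) (carrier G)"
      using ys by (auto simp: aut_orbit_def iso_def)
    have "holds ?M p xs" by (simp add: p A_def)
    then show ?thesis
      using holds_iso[of ?M ?M h xs p] h M G by (simp add: lg_hom_lg_of_group)
  qed
  ultimately have "aut_orbit G xs = {ys. length ys = ?k \<and> set ys \<subseteq> carrier G \<and> holds ?M p ys}"
    unfolding G(2) by blast
  then have "defines_in G p ?k (aut_orbit G xs)" using fvp unfolding defines_in_def by blast
  then show ?thesis using \<open>is_Pi 1 p\<close> by blast
qed

section \<open>From a definable orbit to a Scott sentence\<close>

text \<open>A realization of \<open>\<chi>\<close> in \<open>N\<close> has the atomic type of
  \<open>xs\<close> and so gives an embedding of \<open>G\<close>, which the universal half makes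
  onto. In \<open>G\<close> the realizations are automorphic images of \<open>xs\<close>, so they
  generate.\<close>

lemma dSigma_2_of_orbit_definable:
  fixes G :: "nat monoid"
  assumes G: "group G" "generating_tuple G xs"
    and \<phi>: "is_Pi 1 \<phi>" "defines_in G \<phi> (length xs) (aut_orbit G xs)"
  shows "\<exists>\<phi>. is_dSigma 2 \<phi> \<and> scott_sentence G \<phi>"
proof -
  let ?M = "lg_of_group G" and ?k = "length xs"
  define env where "env ys i = (if i < length ys then ys ! i else \<one>\<^bsub>G\<^esub>)" for ys i
  have holds: "holds ?M \<theta> ys \<longleftrightarrow> sat ?M \<theta> (env ys)" for \<theta> ys
    by (simp add: holds_def env_def[abs_def] cong: if_cong)
  have M: "lg_structure ?M" using G by (simp add: lg_structure_lg_of_group)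
  define Q where "Q = {\<theta>. (\<exists>s t. \<theta> = Eq s t \<or> \<theta> = Neg (Eq s t)) \<and> fv \<theta> \<subseteq> {..<?k} \<and> holds ?M \<theta> xs}"
  have Q: "\<exists>us \<psi>. \<theta> = Alls us \<psi> \<and> finitary_qf \<psi>" if "\<theta> \<in> Q" for \<theta>
    using that by (intro exI[of _ "[]"]) (auto simp: Q_def Alls_def intro: finitary_qf.intros)
  obtain C where C: "\<phi> = Conj C"
    "\<And>\<theta>. \<theta> \<in> rcset C \<Longrightarrow> \<exists>us \<psi>. \<theta> = Alls us \<psi> \<and> finitary_qf \<psi>"
    using \<phi>(1) by (rule is_Pi_1D) blast
  \<comment> \<open>Merging the conjuncts of \<open>\<phi>\<close> with \<open>Q\<close> keeps
    \<open>\<chi>\<close> a single \<open>Conj\<close> of universal formulas, as level 1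
    requires.\<close>
  define B where "B = rcset C \<union> Q"
  have B: "\<exists>us \<psi>. \<theta> = Alls us \<psi> \<and> finitary_qf \<psi>" if "\<theta> \<in> B" for \<theta>
    using that C(2) Q unfolding B_def by blast
  have cB: "countable B"
    using B by (intro countable_subset[OF _ countable_universal]) blast
  define \<chi> where "\<chi> = Conj (acset B)"
  have sat\<chi>: "sat N \<chi> e \<longleftrightarrow> sat N \<phi> e \<and> (\<forall>\<theta>\<in>Q. sat N \<theta> e)" for N :: "nat lg_struct" and e
  proof -
    have "rcset (acset B) = B" using cB by simp
    then show ?thesis unfolding \<chi>_def C(1) sat_Conj by (auto simp: B_def)
  qed
  have fvB: "fv \<theta> \<subseteq> {..<?k}" if "\<theta> \<in> B" for \<theta>
    using that \<phi>(2) unfolding defines_in_def B_def C(1) fv_Conj by (auto simp: Q_def)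
  have fv\<chi>: "fv \<chi> \<subseteq> {..<?k}"
    unfolding \<chi>_def fv_Conj using cB fvB by auto
  \<comment> \<open>Variable \<open>?k\<close>, the first beyond the tuple, stands for an element to
    be written as a word in the tuple.\<close>
  define T where "T = {Eq (Var ?k) t | t. tvars t \<subseteq> {..<?k}}"
  have cT: "countable T"
    by (rule countable_subset[of _ "range (\<lambda>t. Eq (Var ?k) t)"]) (auto simp: T_def)
  \<comment> \<open>The implication from \<open>\<chi>\<close> to being such a word, as one
    disjunction. Negated conjuncts of \<open>\<chi>\<close> are existential, which makes
    \<open>\<delta>\<close> a \<open>\<Sigma>\<^sub>1\<close> formula.\<close>
  define D where "D = dual ` B \<union> T"
  have cD: "countable D" using cB cT by (simp add: D_def)
  define \<delta> where "\<delta> = Disj (acset D)"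
  have sat\<delta>: "sat N \<delta> e \<longleftrightarrow> \<not> sat N \<chi> e \<or> (\<exists>t. tvars t \<subseteq> {..<?k} \<and> e ?k = tval N e t)"
    for N :: "nat lg_struct" and e
    unfolding \<delta>_def sat_Disj_acset[OF cD] \<chi>_def sat_Conj_acset[OF cB]
    unfolding D_def bex_Un by (force simp: T_def)
  have fv\<delta>: "fv \<delta> \<subseteq> {..<Suc ?k}"
  proof -
    have "fv \<theta> \<subseteq> {..<Suc ?k}" if "\<theta> \<in> D" for \<theta>
      using that fvB by (auto simp: D_def T_def less_Suc_eq subset_iff)
    then show ?thesis unfolding \<delta>_def fv_Disj using cD by auto
  qed
  define \<sigma> where "\<sigma> = Disj (csingle (Exs [0..<?k] \<chi>))"
  \<comment> \<open>One variable more than in \<open>\<sigma>\<close>: the tuple together with the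
    element to be generated.\<close>
  define \<pi> where "\<pi> = Conj (csingle (Alls [0..<Suc ?k] \<delta>))"
  have fv\<sigma>: "fv \<sigma> = {}" using fv\<chi> unfolding \<sigma>_def fv_Disj by (auto simp: fv_Exs cinsert.rep_eq bot_cset.rep_eq)
  have fv\<pi>: "fv \<pi> = {}" using fv\<delta> unfolding \<pi>_def fv_Conj by (auto simp: fv_Alls cinsert.rep_eq bot_cset.rep_eq)
  have "is_Pi 1 \<chi>"
    unfolding \<chi>_def
  proof (rule Pi_n)
    show "finite (fv (Conj (acset B)))" using fv\<chi> finite_subset unfolding \<chi>_def by blast
    show "\<forall>\<phi>\<in>rcset (acset B). \<exists>us \<psi> m. \<phi> = Alls us \<psi> \<and> m < 1 \<and> is_Sigma m \<psi>"
      using B Sigma_0 by (simp add: cB) blast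
  qed simp
  then have "is_Sigma 2 \<sigma>"
    unfolding \<sigma>_def
  proof (intro Sigma_n)
    show "finite (fv (Disj (csingle (Exs [0..<?k] \<chi>))))"
      using fv\<sigma> unfolding \<sigma>_def by (metis finite.emptyI)
    show "\<forall>\<phi>\<in>rcset (csingle (Exs [0..<?k] \<chi>)). \<exists>us \<psi> m. \<phi> = Exs us \<psi> \<and> m < 2 \<and> is_Pi m \<psi>"
      using \<open>is_Pi 1 \<chi>\<close>
      by (intro ballI exI[of _ "[0..<?k]"] exI[of _ \<chi>] exI[of _ 1])
        (simp add: cinsert.rep_eq bot_cset.rep_eq)
  qed simp
  have "is_Sigma 1 \<delta>"
    unfolding \<delta>_def
  proof (rule Sigma_n)
    show "finite (fv (Disj (acset D)))" using fv\<delta> finite_subset unfolding \<delta>_def by blast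
    have "\<exists>us \<psi>. \<theta> = Exs us \<psi> \<and> finitary_qf \<psi>" if \<theta>: "\<theta> \<in> D" for \<theta>
    proof (cases "\<theta> \<in> T")
      case True
      then have "\<theta> = Exs [] \<theta>" "finitary_qf \<theta>"
        by (auto simp: T_def Exs_def intro: finitary_qf.intros)
      then show ?thesis by blast
    next
      case False
      then obtain us \<psi> where "\<theta> = dual (Alls us \<psi>)" "finitary_qf \<psi>" using \<theta> B D_def by blast
      then have "\<theta> = Exs us (Neg \<psi>)" "finitary_qf (Neg \<psi>)"
        by (auto simp: dual_Alls intro: finitary_qf.intros)
      then show ?thesis by blast
    qed
    then show "\<forall>\<phi>\<in>rcset (acset D). \<exists>us \<psi> m. \<phi> = Exs us \<psi> \<and> m < 1 \<and> is_Pi m \<psi>"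
      using Pi_0 by (simp add: cD) blast
  qed simp
  then have "is_Pi 2 \<pi>"
    unfolding \<pi>_def
  proof (intro Pi_n)
    show "finite (fv (Conj (csingle (Alls [0..<Suc ?k] \<delta>))))"
      using fv\<pi> unfolding \<pi>_def by (metis finite.emptyI)
    show "\<forall>\<phi>\<in>rcset (csingle (Alls [0..<Suc ?k] \<delta>)). \<exists>us \<psi> m. \<phi> = Alls us \<psi> \<and> m < 2 \<and> is_Sigma m \<psi>"
      using \<open>is_Sigma 1 \<delta>\<close>
      by (intro ballI exI[of _ "[0..<Suc ?k]"] exI[of _ \<delta>] exI[of _ 1])
        (simp add: cinsert.rep_eq bot_cset.rep_eq del: upt_Suc)
  qed simp
  define \<Phi> where "\<Phi> = Conj (cinsert \<sigma> (csingle \<pi>))"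
  have "is_dSigma 2 \<Phi>"
    using \<open>is_Sigma 2 \<sigma>\<close> \<open>is_Pi 2 \<pi>\<close> by (auto simp: is_dSigma_def \<Phi>_def)
  have fv\<Phi>: "fv \<Phi> = {}"
    unfolding \<Phi>_def fv_Conj using fv\<sigma> fv\<pi> by (simp add: cinsert.rep_eq bot_cset.rep_eq)
  have sat\<sigma>: "holds N \<sigma> [] \<longleftrightarrow> (\<exists>v. (\<forall>i<?k. v i \<in> carrier N) \<and> sat N \<chi> v)"
    for N :: "nat lg_struct"
  proof -
    have "sat N \<chi> (override_on e v (set [0..<?k])) \<longleftrightarrow> sat N \<chi> v" for e v
      using fv\<chi> by (intro sat_cong) (auto simp: override_on_def)
    then show ?thesis
      unfolding holds_def \<sigma>_def sat_Disj by (auto simp: cinsert.rep_eq bot_cset.rep_eq sat_Exs atLeast0LessThan)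
  qed
  have sat\<pi>: "holds N \<pi> [] \<longleftrightarrow> (\<forall>v. (\<forall>i<Suc ?k. v i \<in> carrier N) \<longrightarrow> sat N \<delta> v)"
    for N :: "nat lg_struct"
  proof -
    have "sat N \<delta> (override_on e v (set [0..<Suc ?k])) \<longleftrightarrow> sat N \<delta> v" for e v
      using fv\<delta> by (intro sat_cong) (auto simp: override_on_def)
    then show ?thesis
      unfolding holds_def \<pi>_def sat_Conj by (auto simp: cinsert.rep_eq bot_cset.rep_eq sat_Alls atLeast0LessThan simp del: upt_Suc)
  qed
  have sat\<Phi>: "holds N \<Phi> [] \<longleftrightarrow> holds N \<sigma> [] \<and> holds N \<pi> []" for N :: "nat lg_struct"
    unfolding holds_def \<Phi>_def sat_Conj by (simp add: cinsert.rep_eq bot_cset.rep_eq)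
  have orbit: "ys \<in> aut_orbit G xs \<longleftrightarrow> length ys = ?k \<and> set ys \<subseteq> carrier G \<and> holds ?M \<phi> ys" for ys
    using \<phi>(2) by (auto simp: defines_in_def)
  have xs: "set xs \<subseteq> carrier G" "generate G (set xs) = carrier G"
    using G(2) by (auto simp: generating_tuple_def)
  have envG: "env ys i \<in> carrier G" if "set ys \<subseteq> carrier G" for ys i
    using that G(1) by (auto simp: env_def group.is_monoid dest: nth_mem)
  have "xs \<in> aut_orbit G xs"
    unfolding aut_orbit_def by (intro CollectI exI[of _ id]) (auto simp: iso_def hom_def)
  then have "sat ?M \<chi> (env xs)" using orbit by (simp add: sat\<chi> holds[symmetric] Q_def)
  then have "holds ?M \<sigma> []" using sat\<sigma> envG[OF xs(1)] by auto
  moreover have "holds ?M \<pi> []"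
    unfolding sat\<pi>
  proof (intro allI impI)
    fix v assume v: "\<forall>i<Suc ?k. v i \<in> carrier ?M"
    show "sat ?M \<delta> v"
    proof (cases "sat ?M \<chi> v")
      case True
      define ys where "ys = map v [0..<?k]"
      have env: "env ys i = v i" if "i < ?k" for i using that by (simp add: ys_def env_def)
      have "sat ?M \<phi> (env ys) \<longleftrightarrow> sat ?M \<phi> v"
        using \<phi>(2) env by (intro sat_cong) (auto simp: defines_in_def)
      then have "holds ?M \<phi> ys" using True sat\<chi> holds by blast
      then have "ys \<in> aut_orbit G xs" using v by (auto simp: orbit ys_def)
      then obtain h where h: "ys = map h xs" "h \<in> hom G G" "bij_betw h (carrier G) (carrier G)"
        by (auto simp: aut_orbit_def iso_def)
      have "v ?k \<in> carrier G" using v by simp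
      \<comment> \<open>The preimage \<open>g\<close> of \<open>v ?k\<close> under the automorphism
        is a word in \<open>xs\<close>; the same word evaluated at the tuple \<open>ys\<close> gives
        \<open>v ?k\<close>.\<close>
      then obtain g where g: "g \<in> carrier G" "v ?k = h g" using h(3) by (auto simp: bij_betw_def)
      obtain t where t: "tvars t \<subseteq> {..<?k}" "g = tval ?M (env xs) t"
        using generate_eq_tval[of g G xs] xs(2) g(1) by (auto simp: env_def[abs_def])
      have "h g = tval ?M (h \<circ> env xs) t"
        unfolding t(2) using h(2) envG[OF xs(1)] M
        by (intro tval_hom) (simp_all add: lg_hom_lg_of_group G(1))
      also have "\<dots> = tval ?M v t"
      proof (rule tval_cong)
        fix i assume "i \<in> tvars t"
        then have "i < ?k" using t(1) by auto
        then have "v i = map h xs ! i" using h(1) by (metis env env_def length_map)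
        then show "(h \<circ> env xs) i = v i" using \<open>i < ?k\<close> by (simp add: env_def)
      qed
      finally show ?thesis using t(1) g(2) sat\<delta> by auto
    qed (simp add: sat\<delta>)
  qed
  ultimately have \<Phi>: "holds ?M \<Phi> []" using sat\<Phi> by blast
  have "holds N \<Phi> [] \<longleftrightarrow> lg_isomorphic ?M N" if N: "lg_structure N" for N :: "nat lg_struct"
  proof
    assume "lg_isomorphic ?M N"
    then obtain h where "lg_hom ?M N h" "bij_betw h (carrier ?M) (carrier N)"
      by (auto simp: lg_isomorphic_iff)
    then show "holds N \<Phi> []" using holds_iso[of ?M N h "[]" \<Phi>] M \<Phi> by simp
  next
    assume "holds N \<Phi> []"
    then have \<Phi>N: "holds N \<sigma> []" "holds N \<pi> []" using sat\<Phi> by auto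
    obtain b where b: "\<And>i. i < ?k \<Longrightarrow> b i \<in> carrier N" "sat N \<chi> b"
      using \<Phi>N(1) unfolding sat\<sigma> by blast
    have \<delta>: "sat N \<delta> v" if "\<And>i. i < Suc ?k \<Longrightarrow> v i \<in> carrier N" for v
      using \<Phi>N(2) that unfolding sat\<pi> by simp
    \<comment> \<open>\<open>Q\<close> contains the equation or its negation, whichever holds of
      \<open>xs\<close>, so \<open>b\<close> must agree with \<open>xs\<close>.\<close>
    have eq: "tval ?M (env xs) s = tval ?M (env xs) t \<longleftrightarrow> tval N b s = tval N b t"
      if "tvars s \<subseteq> {..<?k}" "tvars t \<subseteq> {..<?k}" for s t
    proof (cases "tval ?M (env xs) s = tval ?M (env xs) t")
      case True
      then have "Eq s t \<in> Q" using that by (simp add: Q_def holds)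
      then have "sat N (Eq s t) b" using b(2) sat\<chi> by blast
      then show ?thesis using True by simp
    next
      case False
      then have "Neg (Eq s t) \<in> Q" using that by (simp add: Q_def holds)
      then have "sat N (Neg (Eq s t)) b" using b(2) sat\<chi> by blast
      then show ?thesis using False by simp
    qed
    obtain h where h: "lg_hom ?M N h" "inj_on h (carrier G)"
      "\<And>t. tvars t \<subseteq> {..<?k} \<Longrightarrow> h (tval ?M (env xs) t) = tval N b t"
      by (rule embedding_from_generators[OF G N env_def _ eq]) (auto simp: b(1))
    have "\<exists>x\<in>carrier G. y = h x" if y: "y \<in> carrier N" for y
    proof -
      \<comment> \<open>Slot \<open>?k\<close> is mentioned neither by \<open>\<chi>\<close> nor by
        words in the tuple, so with \<open>y\<close> placed there \<open>\<delta>\<close> writes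
        \<open>y\<close> as a word in \<open>b\<close>.\<close>
      let ?v = "b(?k := y)"
      have "sat N \<delta> ?v" using b(1) y by (intro \<delta>) auto
      moreover have "sat N \<chi> ?v \<longleftrightarrow> sat N \<chi> b"
        using fv\<chi> by (intro sat_cong) auto
      ultimately obtain t where t: "tvars t \<subseteq> {..<?k}" "y = tval N ?v t"
        using b(2) sat\<delta> by auto
      have "tval N ?v t = tval N b t" using t(1) by (intro tval_cong) auto
      then have "y = h (tval ?M (env xs) t)" using t h(3) by simp
      moreover have "tval ?M (env xs) t \<in> carrier G"
        using tval_closed[OF M, of t "env xs"] envG[OF xs(1)] by simp
      ultimately show ?thesis by blast
    qed
    moreover have "h ` carrier G \<subseteq> carrier N" using h(1) by (auto simp: lg_hom_def hom_def)
    ultimately have "bij_betw h (carrier ?M) (carrier N)"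
      using h(2) by (auto simp: bij_betw_def)
    then show "lg_isomorphic ?M N" using h(1) lg_isomorphic_iff by blast
  qed
  then have "scott_sentence G \<Phi>" using fv\<Phi> by (simp add: scott_sentence_def)
  then show ?thesis using \<open>is_dSigma 2 \<Phi>\<close> by blast
qed

section \<open>Back to \<open>\<Pi>\<^sub>3\<close>, and the cycle of implications\<close>

text \<open>A conjunct of a \<open>\<Pi>\<^sub>3\<close> formula needs a matrix satisfying
  \<open>is_Sigma\<close>, which the conjunction \<open>\<chi>\<close> in general does not. The
  conjuncts of \<open>\<chi>\<close> have the right form, so they are spliced in beside
  \<open>\<psi>\<close>.\<close>

lemma Pi_3_of_dSigma_2:
  assumes "is_dSigma 2 \<phi>" "scott_sentence G \<phi>"
  shows "\<exists>\<phi>. is_Pi 3 \<phi> \<and> scott_sentence G \<phi>"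
proof -
  obtain \<psi> \<chi> where \<phi>: "is_Sigma 2 \<psi>" "is_Pi 2 \<chi>" "\<phi> = Conj (cinsert \<psi> (csingle \<chi>))"
    using assms(1) by (auto simp: is_dSigma_def)
  have "is_Pi (Suc 1) \<chi>" using \<phi>(2) by (simp add: numeral_2_eq_2)
  then obtain C where C: "\<chi> = Conj C"
    "\<And>\<theta>. \<theta> \<in> rcset C \<Longrightarrow> \<exists>us \<psi> m. \<theta> = Alls us \<psi> \<and> m \<le> 1 \<and> is_Sigma m \<psi>"
    by (rule is_Pi_SucD) blast
  define \<Phi> where "\<Phi> = Conj (cinsert \<psi> C)"
  have "fv \<phi> = {}" using assms(2) by (simp add: scott_sentence_def)
  then have fv: "fv \<Phi> = {}"
    unfolding \<phi>(3) \<Phi>_def C(1) fv_Conj by (simp add: cinsert.rep_eq bot_cset.rep_eq fv_Conj del: fv.simps)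
  have "sat N \<Phi> e \<longleftrightarrow> sat N \<phi> e" for N :: "nat lg_struct" and e
    unfolding \<phi>(3) \<Phi>_def C(1) sat_Conj by (simp add: cinsert.rep_eq bot_cset.rep_eq sat_Conj del: sat.simps)
  then have "scott_sentence G \<Phi>"
    using assms(2) fv by (simp add: scott_sentence_def holds_def)
  moreover have "is_Pi 3 \<Phi>"
    unfolding \<Phi>_def
  proof (rule Pi_n)
    show "finite (fv (Conj (cinsert \<psi> C)))" using fv unfolding \<Phi>_def by (metis finite.emptyI)
    \<comment> \<open>The \<open>\<Sigma>\<^sub>2\<close> part enters with an empty block of
      universal quantifiers.\<close>
    have "\<psi> = Alls [] \<psi> \<and> (2::nat) < 3 \<and> is_Sigma 2 \<psi>" using \<phi>(1) by (simp add: Alls_def)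
    moreover have "\<exists>us \<psi> m. \<theta> = Alls us \<psi> \<and> m < 3 \<and> is_Sigma m \<psi>" if \<theta>: "\<theta> \<in> rcset C" for \<theta>
    proof -
      obtain us \<psi>' m where "\<theta> = Alls us \<psi>'" "m \<le> 1" "is_Sigma m \<psi>'" using C(2)[OF \<theta>] by blast
      moreover from this have "m < 3" by simp
      ultimately show ?thesis by blast
    qed
    ultimately show "\<forall>\<phi>\<in>rcset (cinsert \<psi> C). \<exists>us \<psi> m. \<phi> = Alls us \<psi> \<and> m < 3 \<and> is_Sigma m \<psi>"
      unfolding cinsert.rep_eq by blast
  qed simp
  ultimately show ?thesis by blast
qed

theorem theorem4p2:
  fixes G :: "nat monoid"
  assumes "group G" and "carrier G = UNIV" and "fin_generated G"
  shows "((\<exists>\<phi>. is_Pi 3 \<phi> \<and> scott_sentence G \<phi>) \<longleftrightarrow>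
          (\<exists>\<phi>. is_dSigma 2 \<phi> \<and> scott_sentence G \<phi>))
       \<and> ((\<exists>\<phi>. is_dSigma 2 \<phi> \<and> scott_sentence G \<phi>) \<longleftrightarrow>
          (\<exists>xs. generating_tuple G xs \<and>
             (\<exists>\<phi>. is_Pi 1 \<phi> \<and> defines_in G \<phi> (length xs) (aut_orbit G xs))))
       \<and> ((\<exists>xs. generating_tuple G xs \<and>
             (\<exists>\<phi>. is_Pi 1 \<phi> \<and> defines_in G \<phi> (length xs) (aut_orbit G xs))) \<longleftrightarrow>
          (\<forall>xs. generating_tuple G xs \<longrightarrow>
             (\<exists>\<phi>. is_Pi 1 \<phi> \<and> defines_in G \<phi> (length xs) (aut_orbit G xs))))"
proof -
  let ?D = "\<lambda>xs. \<exists>\<phi>. is_Pi 1 \<phi> \<and> defines_in G \<phi> (length xs) (aut_orbit G xs)"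
  let ?P1 = "\<exists>\<phi>. is_Pi 3 \<phi> \<and> scott_sentence G \<phi>"
  let ?P2 = "\<exists>\<phi>. is_dSigma 2 \<phi> \<and> scott_sentence G \<phi>"
  let ?P3 = "\<exists>xs. generating_tuple G xs \<and> ?D xs"
  let ?P4 = "\<forall>xs. generating_tuple G xs \<longrightarrow> ?D xs"
  \<comment> \<open>The cycle runs (1), (4), (3), (2), (1). Finite generation supplies the tuple in
    passing from (4) to (3).\<close>
  have "?P1 \<Longrightarrow> ?P4" using orbit_definable_of_Pi_3 assms by blast
  moreover have "?P4 \<Longrightarrow> ?P3" using assms(3) by (auto simp: fin_generated_def)
  moreover have "?P3 \<Longrightarrow> ?P2" using dSigma_2_of_orbit_definable assms(1) by blast
  moreover have "?P2 \<Longrightarrow> ?P1" using Pi_3_of_dSigma_2 by blast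
  ultimately show ?thesis by argo
qed

end
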